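(* Let $n\ge 1$. For every set $E\subset\mathbb{R}^n$ and every $t\ge 0$, $$b_n^{-1}\,\mathsf{H}^t(E)\le \mathsf{H}^{*t}(E)\le \alpha_n\,\mathsf{H}^t(E),$$ where $\alpha_n=3^n$ and $b_n=(2n)^n$.
   Context: $\mathbb{R}^n$ carries the Euclidean distance; $B(x,r)$ is the closed ball of centre $x$ and radius $r$. Hewitt-Stromberg measure: for $E\subset\mathbb{R}^n$ and $r>0$, $N_r(E)$ is the infimum of the numbers of elements of families of closed balls $(B(x_i,r))_{i\in I}$ with $x_i\in E$ and $E\subseteq\bigcup_iB(x_i,r)$. For $t\ge 0$, $\overline{\mathsf{H}}^t_r(E)=N_r(E)(2r)^t$, $\overline{\mathsf{H}}^t(E)=\liminf_{r\to0}\overline{\mathsf{H}}^t_r(E)$, and $$\mathsf{H}^t(E)=\inf\Big\{\sum_i\overline{\mathsf{H}}^t(E_i) : E\subseteq\bigcup_iE_i\Big\},$$ the infimum being over countable families of subsets of $\mathbb{R}^n$ covering $E$. Binary-cube version: for a non-negative integer $k$, a (half-open) binary cube of side $2^{-k}$ is a set $C=I_1\times\cdots\times I_n$ where each $I_i=[p_i2^{-k},(p_i+1)2^{-k})$ with $p_i$ an integer. $N^*_{2^{-k}}(E)$ is the infimum of the numbers of elements of families of binary cubes of side $2^{-k}$ that cover $E$; $\overline{\mathsf{H}}^{*t}_{2^{-k}}(E)=N^*_{2^{-k}}(E)2^{-kt}$, $\overline{\mathsf{H}}^{*t}(E)=\liminf_{k\to+\infty}\overline{\mathsf{H}}^{*t}_{2^{-k}}(E)$,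 and $$\mathsf{H}^{*t}(E)=\inf\Big\{\sum_i\overline{\mathsf{H}}^{*t}(E_i) : E\subseteq\bigcup_iE_i\Big\},$$ again over countable covers. *)

theory Defs
  imports "HOL-Analysis.Analysis"
begin

text \<open>
  All quantities take values in \<^typ>\<open>ennreal\<close>. Counting measure is the number of elements of a
  family, being \<open>\<infinity>\<close> for infinite families; an infimum over no admissible family is \<open>\<infinity>\<close> as well.
\<close>

definition ball_covering_number :: "real \<Rightarrow> (real ^ 'n) set \<Rightarrow> ennreal" where
  "ball_covering_number r E =
     (INF F \<in> {F. F \<subseteq> (\<lambda>x. cball x r) ` E \<and> E \<subseteq> \<Union>F}. emeasure (count_space UNIV) F)"

definition HS_pre_scale :: "real \<Rightarrow> real \<Rightarrow> (real ^ 'n) set \<Rightarrow> ennreal" where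
  "HS_pre_scale t r E = ball_covering_number r E * ennreal ((2 * r) powr t)"

definition HS_pre :: "real \<Rightarrow> (real ^ 'n) set \<Rightarrow> ennreal" where
  "HS_pre t E = Liminf (at_right 0) (\<lambda>r. HS_pre_scale t r E)"

text \<open>
  Countable covers are sequences; finite covers are included by padding with the empty set, on
  which the premeasures below vanish.
\<close>

definition HS_measure :: "real \<Rightarrow> (real ^ 'n) set \<Rightarrow> ennreal" where
  "HS_measure t E = (INF A \<in> {A :: nat \<Rightarrow> (real ^ 'n) set. E \<subseteq> (\<Union>i. A i)}. \<Sum>i. HS_pre t (A i))"

definition binary_cubes :: "nat \<Rightarrow> (real ^ 'n) set set" where
  "binary_cubes k =
     range (\<lambda>p :: 'n \<Rightarrow> int.
       {x. \<forall>i. x $ i \<in> {of_int (p i) / 2 ^ k ..< (of_int (p i) + 1) / 2 ^ k}})"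

definition cube_covering_number :: "nat \<Rightarrow> (real ^ 'n) set \<Rightarrow> ennreal" where
  "cube_covering_number k E =
     (INF F \<in> {F. F \<subseteq> binary_cubes k \<and> E \<subseteq> \<Union>F}. emeasure (count_space UNIV) F)"

definition HS_cube_pre_scale :: "real \<Rightarrow> nat \<Rightarrow> (real ^ 'n) set \<Rightarrow> ennreal" where
  "HS_cube_pre_scale t k E = cube_covering_number k E * ennreal (2 powr (- (real k * t)))"

definition HS_cube_pre :: "real \<Rightarrow> (real ^ 'n) set \<Rightarrow> ennreal" where
  "HS_cube_pre t E = liminf (\<lambda>k. HS_cube_pre_scale t k E)"

definition HS_cube_measure :: "real \<Rightarrow> (real ^ 'n) set \<Rightarrow> ennreal" where
  "HS_cube_measure t E =
     (INF A \<in> {A :: nat \<Rightarrow> (real ^ 'n) set. E \<subseteq> (\<Union>i. A i)}. \<Sum>i. HS_cube_pre t (A i))"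

end

theory Submission
  imports Defs "HOL-Real_Asymp.Real_Asymp"
begin

text \<open>
  Both inequalities hold already for the premeasures, scale by scale. If \<open>2\<^sup>-\<^sup>k \<le> 2 r < 2 \<cdot> 2\<^sup>-\<^sup>k\<close>,
  each coordinate projection of a ball of radius \<open>r\<close> meets at most three dyadic intervals of length
  \<open>2\<^sup>-\<^sup>k\<close>, so the ball is covered by \<open>3\<^sup>n\<close> cubes. Conversely a cube of side \<open>2\<^sup>-\<^sup>k\<close> splits into
  \<open>(2 n)\<^sup>n\<close> subcubes of \<open>\<ell>\<^sup>1\<close>-diameter at most \<open>n \<cdot> 2\<^sup>-\<^sup>k / (2 n) = 2\<^sup>-\<^sup>k / 2\<close>, hence each subcube that
  meets \<open>E\<close> lies in a ball of radius \<open>2\<^sup>-\<^sup>k / 2\<close> centred at a point of \<open>E\<close>.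
\<close>

section \<open>Comparison up to a constant factor for infima, series and lower limits\<close>

lemma ennreal_le_mult_iff_inverse_mult_le:
  fixes a b c :: ennreal
  assumes "c \<noteq> 0" "c < top"
  shows "a \<le> c * b \<longleftrightarrow> inverse c * a \<le> b"
proof -
  have "c * (inverse c * a) = a"
    using ennreal_divide_self[OF assms] by (simp add: divide_ennreal_def flip: mult.assoc)
  then show ?thesis
    using ennreal_mult_le_mult_iff[of c "inverse c * a" b] assms by auto
qed

text \<open>Dividing by \<open>c\<close> isolates the infimum on the right, so it suffices to bound
  each \<open>g i\<close> from below. An empty \<open>I\<close> is harmless: the right side is then
  infinite.\<close>

lemma INF_le_mult_INF_ennreal:
  fixes f g :: "_ \<Rightarrow> ennreal"
  assumes "c \<noteq> 0" "c < top" and "\<And>i. i \<in> I \<Longrightarrow> \<exists>j\<in>J. f j \<le> c * g i"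
  shows "(INF j\<in>J. f j) \<le> c * (INF i\<in>I. g i)"
  unfolding ennreal_le_mult_iff_inverse_mult_le[OF assms(1,2)]
proof (rule INF_greatest)
  fix i assume "i \<in> I"
  then have "(INF j\<in>J. f j) \<le> c * g i"
    using assms(3) by (meson INF_lower2)
  then show "inverse c * (INF j\<in>J. f j) \<le> g i"
    by (simp add: ennreal_le_mult_iff_inverse_mult_le[OF assms(1,2)])
qed

text \<open>The same cover serves on both sides, so a bound between premeasures passes to the
  measures built from them.\<close>

lemma INF_suminf_le_mult_ennreal:
  fixes f g :: "_ \<Rightarrow> ennreal"
  assumes "c \<noteq> 0" "c < top" and le: "\<And>A. f A \<le> c * g A"
  shows "(INF A\<in>I. \<Sum>i. f (A i)) \<le> c * (INF A\<in>I. \<Sum>i. g (A i))"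
proof (rule INF_le_mult_INF_ennreal[OF assms(1,2)])
  fix A assume "A \<in> I"
  moreover have "(\<Sum>i. f (A i)) \<le> (\<Sum>i. c * g (A i))"
    by (intro suminf_le le) auto
  ultimately show "\<exists>B\<in>I. (\<Sum>i. f (B i)) \<le> c * (\<Sum>i. g (A i))"
    by auto
qed

text \<open>\<open>h\<close> translates one kind of scale into the other. Following \<open>f\<close>
  only along \<open>h\<close> can only raise its lower limit, and multiplication by a finite
  constant is monotone and continuous, hence commutes with \<open>Liminf\<close>.\<close>

lemma Liminf_le_mult_Liminf_ennreal:
  fixes f g :: "_ \<Rightarrow> ennreal"
  assumes "c < top" and h: "filterlim h F G" and "G \<noteq> bot"
    and le: "\<forall>\<^sub>F x in G. f (h x) \<le> c * g x"
  shows "Liminf F f \<le> c * Liminf G g"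
proof -
  have "Liminf F f \<le> Liminf (filtermap h G) f"
    unfolding Liminf_def using h by (intro SUP_subset_mono) (auto simp: filterlim_def le_filter_def)
  also have "\<dots> \<le> Liminf G (\<lambda>x. f (h x))"
    by (rule Liminf_filtermap_le)
  also have "\<dots> \<le> Liminf G (\<lambda>x. c * g x)"
    by (rule Liminf_mono[OF le])
  also have "\<dots> = c * Liminf G g"
    using assms by (intro Liminf_compose_continuous_mono)
      (auto intro!: ennreal_continuous_on_cmult monoI mult_left_mono)
  finally show ?thesis .
qed

section \<open>Counting unions of families and integer boxes\<close>

lemma emeasure_count_space_UN_le:
  assumes "m \<noteq> 0" and "\<And>A. A \<in> F \<Longrightarrow> finite (G A) \<and> card (G A) \<le> m"
  shows "emeasure (count_space UNIV) (\<Union>A\<in>F. G A) \<le> of_nat m * emeasure (count_space UNIV) F"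
proof (cases "finite F")
  case True
  then have "card (\<Union>A\<in>F. G A) \<le> m * card F"
    using card_UN_le[of F G] sum_bounded_above[of F "\<lambda>A. card (G A)" m] assms(2)
    by (fastforce simp: mult.commute)
  then have "of_nat (card (\<Union>A\<in>F. G A)) \<le> (of_nat (m * card F) :: ennreal)"
    by (rule of_nat_mono)
  then show ?thesis
    using True assms(2) by simp
\<comment> \<open>For infinite \<open>F\<close> the right side is \<open>m\<close> times infinity,
  which is infinite because \<open>m\<close> is nonzero.\<close>
qed (use assms(1) in simp)

lemma card_Pi_UNIV:
  fixes T :: "'n::finite \<Rightarrow> 'a set"
  assumes "\<And>i. card (T i) = m" "\<And>i. finite (T i)"
  shows "finite {p. \<forall>i. p i \<in> T i}" "card {p. \<forall>i. p i \<in> T i} = m ^ CARD('n)"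
proof -
  have eq: "{p. \<forall>i. p i \<in> T i} = (\<Pi>\<^sub>E i\<in>UNIV. T i)"
    by (auto simp: PiE_def Pi_def)
  show "finite {p. \<forall>i. p i \<in> T i}"
    unfolding eq by (intro finite_PiE) (auto intro: assms)
  show "card {p. \<forall>i. p i \<in> T i} = m ^ CARD('n)"
    unfolding eq by (subst card_PiE) (auto simp: assms)
qed

section \<open>Covering one ball by cubes, and one cube by balls\<close>

lemma cball_covered_by_binary_cubes:
  fixes x :: "real ^ 'n"
  assumes "2 * r < 2 / 2 ^ k"
  shows "\<exists>G. G \<subseteq> binary_cubes k \<and> finite G \<and> card G \<le> 3 ^ CARD('n) \<and> cball x r \<subseteq> \<Union>G"
proof -
  \<comment> \<open>Index of the dyadic interval containing the left end of the ball's projection to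
    coordinate \<open>i\<close>.\<close>
  define a where "a i = \<lfloor>(x $ i - r) * 2 ^ k\<rfloor>" for i
  define P where "P = {p. \<forall>i. p i \<in> {a i..a i + 2}}"
  define C :: "('n \<Rightarrow> int) \<Rightarrow> (real ^ 'n) set"
    where "C p = {x. \<forall>i. x $ i \<in> {of_int (p i) / 2 ^ k ..< (of_int (p i) + 1) / 2 ^ k}}" for p
  have P: "finite P" "card P = 3 ^ CARD('n)"
    unfolding P_def by (rule card_Pi_UNIV; simp)+
  have "y \<in> \<Union> (C ` P)" if "y \<in> cball x r" for y
  proof (rule UnionI)
    let ?p = "\<lambda>i. \<lfloor>y $ i * 2 ^ k\<rfloor>"
    have "?p i \<in> {a i..a i + 2}" for i
    proof -
      have "\<bar>x $ i - y $ i\<bar> \<le> r"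
        using component_le_norm_cart[of "x - y" i] that by (simp add: dist_norm)
      then have "(x $ i - r) * 2 ^ k \<le> y $ i * 2 ^ k" "y $ i * 2 ^ k \<le> (x $ i - r + 2 * r) * 2 ^ k"
        by (auto intro!: mult_right_mono)
      then have "(x $ i - r) * 2 ^ k \<le> y $ i * 2 ^ k" "y $ i * 2 ^ k \<le> (x $ i - r) * 2 ^ k + 2 * r * 2 ^ k"
        by (simp_all only: distrib_right)
      \<comment> \<open>The left end is below \<open>a i + 1\<close> after rescaling, and the
        projection has length below 2, so every point of it is below \<open>a i + 3\<close> and has
        floor at most \<open>a i + 2\<close>.\<close>
      moreover have "2 * r * 2 ^ k < 2"
        using assms by (simp add: field_simps)
      ultimately show ?thesis
        unfolding a_def atLeastAtMost_iff by linarith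
    qed
    then show "C ?p \<in> C ` P"
      by (auto simp: P_def)
    show "y \<in> C ?p"
      by (auto simp: C_def field_simps) linarith
  qed
  moreover have "C ` P \<subseteq> binary_cubes k"
    by (auto simp: binary_cubes_def C_def)
  moreover have "card (C ` P) \<le> 3 ^ CARD('n)"
    using card_image_le[of P C] P by simp
  ultimately show ?thesis
    using P by (intro exI[of _ "C ` P"]) auto
qed

lemma binary_cube_covered_by_cballs:
  fixes E :: "(real ^ 'n) set"
  assumes "C \<in> binary_cubes k"
  shows "\<exists>G. G \<subseteq> (\<lambda>x. cball x (1 / 2 ^ Suc k)) ` E \<and> finite G
           \<and> card G \<le> (2 * CARD('n)) ^ CARD('n) \<and> C \<inter> E \<subseteq> \<Union>G"
proof -
  let ?n = "CARD('n)"
  obtain p :: "'n \<Rightarrow> int"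
    where C: "C = {x. \<forall>i. x $ i \<in> {of_int (p i) / 2 ^ k ..< (of_int (p i) + 1) / 2 ^ k}}"
    using assms by (auto simp: binary_cubes_def)
  \<comment> \<open>\<open>q y\<close> is the position, inside \<open>C\<close>, of the subcube of
    side \<open>1 / (2 ^ k * (2 * n))\<close> that contains \<open>y\<close>.\<close>
  define q where "q y = (\<lambda>i. \<lfloor>(y $ i * 2 ^ k - p i) * real (2 * ?n)\<rfloor>)" for y :: "real ^ 'n"
  \<comment> \<open>Centres have to lie in \<open>E\<close>, so each subcube that meets
    \<open>E\<close> gets a representative there; \<open>z v\<close> is unspecified off
    \<open>Q\<close>.\<close>
  define z where "z v = (SOME y. y \<in> C \<inter> E \<and> q y = v)" for v
  define Q where "Q = q ` (C \<inter> E)"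
  have z: "z v \<in> C \<inter> E \<and> q (z v) = v" if "v \<in> Q" for v
    unfolding z_def by (rule someI_ex) (use that in \<open>auto simp: Q_def\<close>)
  have sub: "Q \<subseteq> {v. \<forall>i. v i \<in> {0..<int (2 * ?n)}}"
  proof -
    have "q y i \<in> {0..<int (2 * ?n)}" if "y \<in> C" for y i
    proof -
      have "0 \<le> y $ i * 2 ^ k - p i" "y $ i * 2 ^ k - p i < 1"
        using that by (auto simp: C field_simps)
      then have "0 \<le> (y $ i * 2 ^ k - p i) * real (2 * ?n)"
          "(y $ i * 2 ^ k - p i) * real (2 * ?n) < real (2 * ?n)"
        by (auto intro!: mult_nonneg_nonneg)
      then show ?thesis
        by (simp add: q_def floor_less_iff)
    qed
    then show ?thesis by (auto simp: Q_def)
  qed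
  have fin: "finite {v::'n \<Rightarrow> int. \<forall>i. v i \<in> {0..<int (2 * ?n)}}"
    and card: "card {v::'n \<Rightarrow> int. \<forall>i. v i \<in> {0..<int (2 * ?n)}} = (2 * ?n) ^ ?n"
    by (rule card_Pi_UNIV; simp)+
  have Q: "finite Q" "card Q \<le> (2 * ?n) ^ ?n"
    using finite_subset[OF sub fin] card_mono[OF fin sub] card by auto
  have "y \<in> cball (z (q y)) (1 / 2 ^ Suc k)" if "y \<in> C \<inter> E" for y
  proof -
    have eq: "q (z (q y)) = q y"
      using z[of "q y"] that by (auto simp: Q_def)
    have "\<bar>(z (q y) - y) $ i\<bar> \<le> 1 / 2 ^ Suc k / real ?n" for i
    proof -
      \<comment> \<open>Numbers with equal floors differ by less than 1.\<close>
      have "\<bar>(z (q y) $ i * 2 ^ k - p i) * real (2 * ?n) - (y $ i * 2 ^ k - p i) * real (2 * ?n)\<bar> < 1"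
        using fun_cong[OF eq, of i] unfolding q_def by linarith
      also have "(z (q y) $ i * 2 ^ k - p i) * real (2 * ?n) - (y $ i * 2 ^ k - p i) * real (2 * ?n)
          = (z (q y) - y) $ i * (2 ^ Suc k * real ?n)"
        by (simp add: algebra_simps)
      finally have "\<bar>(z (q y) - y) $ i\<bar> * (2 ^ Suc k * real ?n) < 1"
        by (simp add: abs_mult)
      then show ?thesis
        by (simp add: field_simps)
    qed
    \<comment> \<open>Summing the \<open>n\<close> coordinate bounds cancels the division by
      \<open>n\<close>; the sum dominates the Euclidean norm.\<close>
    then have "(\<Sum>i\<in>UNIV. \<bar>(z (q y) - y) $ i\<bar>) \<le> real ?n * (1 / 2 ^ Suc k / real ?n)"
      by (intro sum_bounded_above)
    then have "norm (z (q y) - y) \<le> 1 / 2 ^ Suc k"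
      using norm_le_l1_cart[of "z (q y) - y"] by simp
    then show ?thesis by (simp add: dist_norm)
  qed
  moreover have "card ((\<lambda>v. cball (z v) (1 / 2 ^ Suc k)) ` Q) \<le> (2 * ?n) ^ ?n"
    using card_image_le[OF Q(1)] Q(2) le_trans by blast
  ultimately show ?thesis
    using Q(1) z by (intro exI[of _ "(\<lambda>v. cball (z v) (1 / 2 ^ Suc k)) ` Q"]) (auto simp: Q_def)
qed

section \<open>Comparison of covering numbers at a fixed scale\<close>

lemma cube_covering_number_le:
  fixes E :: "(real ^ 'n) set"
  assumes "2 * r < 2 / 2 ^ k"
  shows "cube_covering_number k E \<le> 3 ^ CARD('n) * ball_covering_number r E"
  unfolding cube_covering_number_def ball_covering_number_def
proof (rule INF_le_mult_INF_ennreal)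
  fix F assume F: "F \<in> {F. F \<subseteq> (\<lambda>x. cball x r) ` E \<and> E \<subseteq> \<Union>F}"
  have "\<forall>A\<in>F. \<exists>G. G \<subseteq> binary_cubes k \<and> finite G \<and> card G \<le> 3 ^ CARD('n) \<and> A \<subseteq> \<Union>G"
    using F cball_covered_by_binary_cubes[OF assms] by blast
  then obtain G where G: "\<And>A. A \<in> F \<Longrightarrow>
      G A \<subseteq> binary_cubes k \<and> finite (G A) \<and> card (G A) \<le> 3 ^ CARD('n) \<and> A \<subseteq> \<Union>(G A)"
    by metis
  show "\<exists>H\<in>{F. F \<subseteq> binary_cubes k \<and> E \<subseteq> \<Union>F}.
      emeasure (count_space UNIV) H \<le> 3 ^ CARD('n) * emeasure (count_space UNIV) F"
  proof
    show "emeasure (count_space UNIV) (\<Union>A\<in>F. G A) \<le> 3 ^ CARD('n) * emeasure (count_space UNIV) F"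
      using emeasure_count_space_UN_le[of "3 ^ CARD('n)" F G] G by simp
    have "E \<subseteq> \<Union>F" using F by blast
    then show "(\<Union>A\<in>F. G A) \<in> {F. F \<subseteq> binary_cubes k \<and> E \<subseteq> \<Union>F}"
      using G by blast
  qed
qed (auto simp: power_less_top_ennreal)

text \<open>Only the traces of the cubes on \<open>E\<close> have to be covered, which permits
  centres in \<open>E\<close>. The radius is half the side, so that \<open>2 * r\<close> is exactly
  the side of the cubes.\<close>

lemma ball_covering_number_le:
  fixes E :: "(real ^ 'n) set"
  shows "ball_covering_number (1 / 2 ^ Suc k) E
    \<le> (2 * of_nat CARD('n)) ^ CARD('n) * cube_covering_number k E"
  unfolding cube_covering_number_def ball_covering_number_def
proof (rule INF_le_mult_INF_ennreal)
  let ?balls = "(\<lambda>x. cball x (1 / 2 ^ Suc k)) ` E"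
  fix F :: "(real ^ 'n) set set" assume F: "F \<in> {F. F \<subseteq> binary_cubes k \<and> E \<subseteq> \<Union>F}"
  have "\<forall>A\<in>F. \<exists>G. G \<subseteq> ?balls \<and> finite G \<and> card G \<le> (2 * CARD('n)) ^ CARD('n) \<and> A \<inter> E \<subseteq> \<Union>G"
    using F binary_cube_covered_by_cballs[of _ k E] by blast
  then obtain G where G: "\<And>A. A \<in> F \<Longrightarrow>
      G A \<subseteq> ?balls \<and> finite (G A) \<and> card (G A) \<le> (2 * CARD('n)) ^ CARD('n) \<and> A \<inter> E \<subseteq> \<Union>(G A)"
    by metis
  show "\<exists>H\<in>{F. F \<subseteq> ?balls \<and> E \<subseteq> \<Union>F}. emeasure (count_space UNIV) H
      \<le> (2 * of_nat CARD('n)) ^ CARD('n) * emeasure (count_space UNIV) F"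
  proof
    show "emeasure (count_space UNIV) (\<Union>A\<in>F. G A)
        \<le> (2 * of_nat CARD('n)) ^ CARD('n) * emeasure (count_space UNIV) F"
      using emeasure_count_space_UN_le[of "(2 * CARD('n)) ^ CARD('n)" F G] G by simp
    have "E \<subseteq> \<Union>F" using F by blast
    then show "(\<Union>A\<in>F. G A) \<in> {F. F \<subseteq> ?balls \<and> E \<subseteq> \<Union>F}"
      using G by blast
  qed
qed (auto simp: power_less_top_ennreal ennreal_mult_less_top of_nat_less_top)

section \<open>Comparison of premeasures, then of measures\<close>

lemma HS_cube_pre_le:
  fixes E :: "(real ^ 'n) set"
  assumes "t \<ge> 0"
  shows "HS_cube_pre t E \<le> 3 ^ CARD('n) * HS_pre t E"
  unfolding HS_cube_pre_def HS_pre_def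
proof (rule Liminf_le_mult_Liminf_ennreal)
  \<comment> \<open>For small \<open>r\<close> this is the least \<open>k\<close> with
    \<open>1 / 2 ^ k \<le> 2 * r\<close>. That inequality compares the powers with exponent
    \<open>t\<close>; minimality gives \<open>2 * r < 2 / 2 ^ k\<close>, which the counting bound
    requires.\<close>
  let ?k = "\<lambda>r::real. nat \<lceil>- log 2 (2 * r)\<rceil>"
  show "filterlim ?k sequentially (at_right 0)"
    by real_asymp
  \<comment> \<open>Below \<open>1 / 2\<close> the negated logarithm is positive, so
    \<open>nat\<close> does not truncate the ceiling.\<close>
  have "\<forall>\<^sub>F r in at_right 0. r \<in> {0<..<1 / 2 :: real}"
    by (rule eventually_at_right_real) simp
  then show "\<forall>\<^sub>F r in at_right 0.
      HS_cube_pre_scale t (?k r) E \<le> 3 ^ CARD('n) * HS_pre_scale t r E"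
  proof eventually_elim
    case (elim r)
    have "- log 2 (2 * r) > 0"
      using elim by simp
    then have k: "- log 2 (2 * r) \<le> real (?k r)" "real (?k r) < - log 2 (2 * r) + 1"
      by linarith+
    have "2 powr - real (?k r) \<le> 2 powr log 2 (2 * r)"
      using k by (intro powr_mono) linarith+
    also have "\<dots> = 2 * r"
      using elim by simp
    finally have lower: "2 powr - real (?k r) \<le> 2 * r" .
    have "2 powr log 2 (2 * r) < 2 powr (1 - real (?k r))"
      using k by (intro powr_less_mono) auto
    then have upper: "2 * r < 2 / 2 ^ ?k r"
      using elim by (simp add: powr_diff powr_realpow)
    have "2 powr - (real (?k r) * t) = (2 powr - real (?k r)) powr t"
      by (simp add: powr_powr)
    also have "\<dots> \<le> (2 * r) powr t"
      using lower assms by (intro powr_mono2) auto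
    finally show ?case
      unfolding HS_cube_pre_scale_def HS_pre_scale_def mult.assoc[symmetric]
      using cube_covering_number_le[OF upper] by (intro mult_mono ennreal_leI) auto
  qed
qed (auto simp: power_less_top_ennreal)

text \<open>The lower limit over all radii is at most the one along the radii
  \<open>1 / 2 ^ Suc k\<close>, where the power factors of the two premeasures coincide and only the
  covering numbers remain to be compared.\<close>

lemma HS_pre_le:
  fixes E :: "(real ^ 'n) set"
  shows "HS_pre t E \<le> (2 * of_nat CARD('n)) ^ CARD('n) * HS_cube_pre t E"
  unfolding HS_cube_pre_def HS_pre_def
proof (rule Liminf_le_mult_Liminf_ennreal)
  show "filterlim (\<lambda>k. 1 / 2 ^ Suc k :: real) (at_right 0) sequentially"
    by real_asymp
  have "(2 * (1 / 2 ^ Suc k)) powr t = 2 powr - (real k * t)" for k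
  proof -
    have "2 * (1 / 2 ^ Suc k) = (2::real) powr - real k"
      by (simp add: powr_minus powr_realpow field_simps)
    then show ?thesis by (simp add: powr_powr)
  qed
  then show "\<forall>\<^sub>F k in sequentially. HS_pre_scale t (1 / 2 ^ Suc k) E
      \<le> (2 * of_nat CARD('n)) ^ CARD('n) * HS_cube_pre_scale t k E"
    unfolding HS_cube_pre_scale_def HS_pre_scale_def mult.assoc[symmetric]
    using ball_covering_number_le[of _ E] by (intro always_eventually allI mult_mono) auto
qed (auto simp: power_less_top_ennreal ennreal_mult_less_top of_nat_less_top)

theorem proposition2:
  fixes E :: "(real ^ 'n) set" and t :: real
  assumes "t \<ge> 0"
  shows "inverse ((2 * of_nat CARD('n)) ^ CARD('n)) * HS_measure t E \<le> HS_cube_measure t E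
       \<and> HS_cube_measure t E \<le> 3 ^ CARD('n) * HS_measure t E"
proof
  let ?b = "(2 * of_nat CARD('n)) ^ CARD('n) :: ennreal"
  have b: "?b \<noteq> 0" "?b < top"
    by (auto simp: power_less_top_ennreal ennreal_mult_less_top of_nat_less_top)
  have "HS_measure t E \<le> ?b * HS_cube_measure t E"
    unfolding HS_measure_def HS_cube_measure_def
    by (rule INF_suminf_le_mult_ennreal[OF b HS_pre_le])
  then show "inverse ?b * HS_measure t E \<le> HS_cube_measure t E"
    by (simp only: ennreal_le_mult_iff_inverse_mult_le[OF b])
  show "HS_cube_measure t E \<le> 3 ^ CARD('n) * HS_measure t E"
    unfolding HS_measure_def HS_cube_measure_def
    by (rule INF_suminf_le_mult_ennreal[OF _ _ HS_cube_pre_le[OF assms]])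
      (auto simp: power_less_top_ennreal)
qed

end
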